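(* Let $\Sigma\subset\mathbf{E}_1^3$ be an intrinsic rotational surface, with coordinates $(u,v)$, having twist $\alpha=\alpha(v)$, where $\alpha$ is not identically zero. Assume that $\Sigma$ has no open sets of umbilic points. If $\Sigma$ is spacelike, assume in addition that $\alpha$ is not an integer multiple of $\frac{\pi}{2}$ on any open interval. Then $\Sigma$ has constant mean curvature and there are $a,c\in\mathbb{R}$ such that $\alpha(v)=av+c$.
   Context: $\mathbf{E}_1^3$ is $\mathbb{R}^3$ with the Lorentzian metric $\langle,\rangle=dx_1^2+dx_2^2-dx_3^2$. A non-degenerate (smooth) surface in $\mathbf{E}_1^3$ is spacelike if its induced metric is Riemannian and timelike if it is Lorentzian. A non-degenerate surface $\Sigma$ is an intrinsic rotational surface if it has local coordinates $(u,v)$, ranging over a product of open intervals, in which the first fundamental form is $\mathrm{I}=\rho(u)^2(\delta\,du^2+\epsilon\,dv^2)$ with $\delta,\epsilon\in\{-1,1\}$ (not both $-1$) and $\rho>0$ a smooth function of $u$ only. Let $N$ be a unit normal field, $\langle N,N\rangle=-\sigma$, where $\sigma=1$ if $\Sigma$ is spacelike and $\sigma=-1$ if $\Sigma$ is timelike. The Weingarten endomorphism is $AX=-(\nabla^0_XN)^\top$, with $\nabla^0$ the Levi-Civita connection of $\mathbf{E}_1^3$. When $A$ is (real) diagonalizable, its eigenvalues $\lambda_1,\lambda_2$ are the principal curvatures; the mean curvature is $H=-\sigma\frac{\lambda_1+\lambda_2}{2}$; a point is umbilic if $\lambda_1=\lambda_2$ there. Put $R_\theta=\begin{pmatrix}\cos\theta&-\sin\theta\\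 \sin\theta&\cos\theta\end{pmatrix}$ and $G_\theta=\begin{pmatrix}\cosh\theta&\sinh\theta\\ \sinh\theta&\cosh\theta\end{pmatrix}$. For a smooth function $\alpha$ of $v$, the intrinsic rotational surface $\Sigma$ has twist $\alpha$ if $A$ is diagonalizable and the matrix of $A$ with respect to $\{\partial_u,\partial_v\}$ is $R_{-\alpha(v)}\,\mathrm{diag}(\lambda_1(u),\lambda_2(u))\,R_{\alpha(v)}$ when $\Sigma$ is spacelike, respectively $G_{-\alpha(v)}\,\mathrm{diag}(\lambda_1(u),\lambda_2(u))\,G_{\alpha(v)}$ when $\Sigma$ is timelike, where the principal curvatures $\lambda_1,\lambda_2$ depend only on $u$. *)

theory Defs
  imports "HOL-Analysis.Analysis"
begin

text \<open>\<open>C\<^sup>k\<close> and \<open>C\<^sup>\<infinity>\<close> maps on an open set \<open>S\<close>.\<close>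

primrec Ck_on :: "nat \<Rightarrow> ('a::real_normed_vector \<Rightarrow> 'b::real_normed_vector) \<Rightarrow> 'a set \<Rightarrow> bool" where
  "Ck_on 0 f S \<longleftrightarrow> continuous_on S f"
| "Ck_on (Suc k) f S \<longleftrightarrow>
     (\<forall>x\<in>S. f differentiable (at x)) \<and> (\<forall>h. Ck_on k (\<lambda>x. frechet_derivative f (at x) h) S)"

definition smooth_on :: "'a::real_normed_vector set \<Rightarrow> ('a \<Rightarrow> 'b::real_normed_vector) \<Rightarrow> bool" where
  "smooth_on S f \<longleftrightarrow> (\<forall>k. Ck_on k f S)"

text \<open>Nonempty open intervals, bounded or not.\<close>

definition open_interval :: "real set \<Rightarrow> bool" where
  "open_interval K \<longleftrightarrow> open K \<and> is_interval K \<and> K \<noteq> {}"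

definition lorentz :: "real^3 \<Rightarrow> real^3 \<Rightarrow> real" where
  "lorentz x y = x $ 1 * y $ 1 + x $ 2 * y $ 2 - x $ 3 * y $ 3"

text \<open>
  A surface is given by a parametrization \<open>X\<close> on an open set \<open>D\<close> of coordinates \<open>(u, v)\<close>. A tangent
  vector at the point with coordinates \<open>p\<close> is written in coordinates: \<open>\<xi> = (a, b)\<close> stands for
  \<open>a \<partial>\<^sub>u + b \<partial>\<^sub>v\<close>, and \<open>tangent_map X p \<xi>\<close> is this vector as an element of \<open>\<real>\<^sup>3\<close>.
\<close>

definition tangent_map :: "(real \<times> real \<Rightarrow> real^3) \<Rightarrow> real \<times> real \<Rightarrow> real \<times> real \<Rightarrow> real^3" where
  "tangent_map X p = frechet_derivative X (at p)"

definition first_fundamental_form ::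
    "(real \<times> real \<Rightarrow> real^3) \<Rightarrow> real \<times> real \<Rightarrow> real \<times> real \<Rightarrow> real \<times> real \<Rightarrow> real" where
  "first_fundamental_form X p \<xi> \<eta> = lorentz (tangent_map X p \<xi>) (tangent_map X p \<eta>)"

definition spacelike :: "(real \<times> real \<Rightarrow> real^3) \<Rightarrow> (real \<times> real) set \<Rightarrow> bool" where
  "spacelike X D \<longleftrightarrow> (\<forall>p\<in>D. \<forall>\<xi>. \<xi> \<noteq> 0 \<longrightarrow> first_fundamental_form X p \<xi> \<xi> > 0)"

text \<open>On a 2-dimensional space a symmetric bilinear form is Lorentzian iff it takes both signs.\<close>

definition timelike :: "(real \<times> real \<Rightarrow> real^3) \<Rightarrow> (real \<times> real) set \<Rightarrow> bool" where
  "timelike X D \<longleftrightarrow> (\<forall>p\<in>D. \<exists>\<xi> \<eta>.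
     first_fundamental_form X p \<xi> \<xi> < 0 \<and> first_fundamental_form X p \<eta> \<eta> > 0)"

definition nondegenerate_surface :: "(real \<times> real \<Rightarrow> real^3) \<Rightarrow> (real \<times> real) set \<Rightarrow> bool" where
  "nondegenerate_surface X D \<longleftrightarrow>
     open D \<and> smooth_on D X \<and> (\<forall>p\<in>D. inj (tangent_map X p)) \<and> (spacelike X D \<or> timelike X D)"

definition intrinsic_rotational_surface ::
    "(real \<times> real \<Rightarrow> real^3) \<Rightarrow> real set \<Rightarrow> real set \<Rightarrow> bool" where
  "intrinsic_rotational_surface X I J \<longleftrightarrow>
     open_interval I \<and> open_interval J \<and> nondegenerate_surface X (I \<times> J) \<and>
     (\<exists>(\<rho>::real \<Rightarrow> real) (\<delta>::real) (\<epsilon>::real).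
        smooth_on I \<rho> \<and> (\<forall>u\<in>I. \<rho> u > 0) \<and>
        \<delta> \<in> {-1, 1} \<and> \<epsilon> \<in> {-1, 1} \<and> \<not> (\<delta> = -1 \<and> \<epsilon> = -1) \<and>
        (\<forall>u\<in>I. \<forall>v\<in>J. \<forall>a b. first_fundamental_form X (u, v) (a, b) (a, b)
           = (\<rho> u)\<^sup>2 * (\<delta> * a\<^sup>2 + \<epsilon> * b\<^sup>2)))"

text \<open>The sign \<open>\<sigma>\<close>; for a nondegenerate surface the second case is the timelike one.\<close>

definition causal_sign :: "(real \<times> real \<Rightarrow> real^3) \<Rightarrow> (real \<times> real) set \<Rightarrow> real" where
  "causal_sign X D = (if spacelike X D then 1 else -1)"

definition unit_normal_field ::
    "(real \<times> real \<Rightarrow> real^3) \<Rightarrow> (real \<times> real \<Rightarrow> real^3) \<Rightarrow> (real \<times> real) set \<Rightarrow> bool" where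
  "unit_normal_field X N D \<longleftrightarrow> smooth_on D N \<and>
     (\<forall>p\<in>D. (\<forall>\<xi>. lorentz (N p) (tangent_map X p \<xi>) = 0) \<and> lorentz (N p) (N p) = - causal_sign X D)"

text \<open>
  Orthogonal decomposition along a non-null normal \<open>n\<close>: the part of \<open>w\<close> tangent to the surface.
\<close>

definition tangential_part :: "real^3 \<Rightarrow> real^3 \<Rightarrow> real^3" where
  "tangential_part n w = w - (lorentz w n / lorentz n n) *\<^sub>R n"

text \<open>
  The Levi-Civita connection of the flat metric is componentwise differentiation, so the covariant
  derivative of \<open>N\<close> in the direction \<open>\<xi>\<close> is the differential of \<open>N\<close> applied to \<open>\<xi>\<close>. The value
  of the endomorphism is given as a vector of \<open>\<real>\<^sup>3\<close>, to be compared with \<open>tangent_map X p\<close>.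
\<close>

definition weingarten ::
    "(real \<times> real \<Rightarrow> real^3) \<Rightarrow> real \<times> real \<Rightarrow> real \<times> real \<Rightarrow> real^3" where
  "weingarten N p \<xi> = - tangential_part (N p) (frechet_derivative N (at p) \<xi>)"

text \<open>\<open>M\<close> is the matrix of the Weingarten endomorphism at \<open>p\<close> with respect to \<open>\<partial>\<^sub>u, \<partial>\<^sub>v\<close>
  (columns are the images of the basis vectors).\<close>

definition is_weingarten_matrix ::
    "(real \<times> real \<Rightarrow> real^3) \<Rightarrow> (real \<times> real \<Rightarrow> real^3) \<Rightarrow> real \<times> real \<Rightarrow> real^2^2 \<Rightarrow> bool" where
  "is_weingarten_matrix X N p M \<longleftrightarrow>
     weingarten N p (1, 0)
       = (M $ 1 $ 1) *\<^sub>R tangent_map X p (1, 0) + (M $ 2 $ 1) *\<^sub>R tangent_map X p (0, 1) \<and>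
     weingarten N p (0, 1)
       = (M $ 1 $ 2) *\<^sub>R tangent_map X p (1, 0) + (M $ 2 $ 2) *\<^sub>R tangent_map X p (0, 1)"

text \<open>The Weingarten endomorphism at \<open>p\<close> is real diagonalizable, with eigenvalues
  \<open>l1, l2\<close> counted with multiplicity.\<close>

definition principal_curvatures ::
    "(real \<times> real \<Rightarrow> real^3) \<Rightarrow> (real \<times> real \<Rightarrow> real^3) \<Rightarrow> real \<times> real \<Rightarrow> real \<Rightarrow> real \<Rightarrow> bool" where
  "principal_curvatures X N p l1 l2 \<longleftrightarrow>
     (\<exists>\<xi> \<eta>. \<xi> \<noteq> \<eta> \<and> independent {\<xi>, \<eta>} \<and>
        weingarten N p \<xi> = l1 *\<^sub>R tangent_map X p \<xi> \<and>
        weingarten N p \<eta> = l2 *\<^sub>R tangent_map X p \<eta>)"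

definition umbilic ::
    "(real \<times> real \<Rightarrow> real^3) \<Rightarrow> (real \<times> real \<Rightarrow> real^3) \<Rightarrow> real \<times> real \<Rightarrow> bool" where
  "umbilic X N p \<longleftrightarrow> (\<exists>l1 l2. principal_curvatures X N p l1 l2 \<and> l1 = l2)"

definition mean_curvature ::
    "(real \<times> real \<Rightarrow> real^3) \<Rightarrow> (real \<times> real \<Rightarrow> real^3) \<Rightarrow> (real \<times> real) set \<Rightarrow> real \<times> real \<Rightarrow> real" where
  "mean_curvature X N D p =
     (THE H. \<exists>l1 l2. principal_curvatures X N p l1 l2 \<and> H = - causal_sign X D * ((l1 + l2) / 2))"

definition rot :: "real \<Rightarrow> real^2^2" where
  "rot \<theta> = vector [vector [cos \<theta>, - sin \<theta>], vector [sin \<theta>, cos \<theta>]]"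

definition boost :: "real \<Rightarrow> real^2^2" where
  "boost \<theta> = vector [vector [cosh \<theta>, sinh \<theta>], vector [sinh \<theta>, cosh \<theta>]]"

definition diag2 :: "real \<Rightarrow> real \<Rightarrow> real^2^2" where
  "diag2 a b = vector [vector [a, 0], vector [0, b]]"

definition has_twist ::
    "(real \<times> real \<Rightarrow> real^3) \<Rightarrow> (real \<times> real \<Rightarrow> real^3) \<Rightarrow> real set \<Rightarrow> real set \<Rightarrow> (real \<Rightarrow> real) \<Rightarrow> bool" where
  "has_twist X N I J \<alpha> \<longleftrightarrow> smooth_on J \<alpha> \<and>
     (\<exists>l1 l2 :: real \<Rightarrow> real. \<forall>u\<in>I. \<forall>v\<in>J.
        principal_curvatures X N (u, v) (l1 u) (l2 u) \<and>
        is_weingarten_matrix X N (u, v)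
          (if spacelike X (I \<times> J)
           then rot (- \<alpha> v) ** diag2 (l1 u) (l2 u) ** rot (\<alpha> v)
           else boost (- \<alpha> v) ** diag2 (l1 u) (l2 u) ** boost (\<alpha> v)))"

end

theory Submission
  imports Defs
begin

text \<open>
  Write \<open>h = (\<lambda>\<^sub>1 + \<lambda>\<^sub>2) / 2\<close> and \<open>w = (\<lambda>\<^sub>1 - \<lambda>\<^sub>2) / 2\<close>, two functions of \<open>u\<close>. Conjugating
  \<open>diag(\<lambda>\<^sub>1, \<lambda>\<^sub>2)\<close> by the rotation or boost of angle \<open>\<alpha>(v)\<close> gives the matrix \<open>h\<close> times the identity
  plus \<open>w\<close> times a traceless matrix with entries \<open>\<plusminus>C(v)\<close> and \<open>\<plusminus>S(v)\<close>, where \<open>(C, S)\<close> is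
  \<open>(cos 2\<alpha>, sin 2\<alpha>)\<close> or \<open>(cosh 2\<alpha>, sinh 2\<alpha>)\<close>. The variables are thus separated, and with
  \<open>P = \<rho>\<^sup>2 w\<close> the two Codazzi equations become
  \<open>S(v) (P'(u) - 2 \<alpha>'(v) P(u)) = 0\<close> and \<open>C(v) (P'(u) - 2 \<alpha>'(v) P(u)) = \<rho>(u)\<^sup>2 h'(u)\<close>
  (lemma \<open>codazzi_twist\<close>).

  A single \<open>v\<^sub>0\<close> with \<open>S(v\<^sub>0) \<noteq> 0\<close> decides everything. At \<open>v = v\<^sub>0\<close> the first equation makes the
  bracket vanish for every \<open>u\<close>, and then the second one says \<open>h' = 0\<close>: the mean curvature, which is
  \<open>\<plusminus>h\<close>, is constant. Now the bracket is annihilated by both \<open>S(v)\<close> and \<open>C(v)\<close>, for every \<open>v\<close>; as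
  they do not vanish simultaneously, \<open>P'(u) = 2 \<alpha>'(v) P(u)\<close> everywhere. At one \<open>u\<^sub>0\<close> with
  \<open>w(u\<^sub>0) \<noteq> 0\<close> this determines \<open>\<alpha>'(v)\<close> independently of \<open>v\<close>, so \<open>\<alpha>\<close> is affine (lemma \<open>rigidity\<close>).

  The hypotheses provide the two points. If \<open>w\<close> were identically zero, all points would be umbilic.
  In the timelike case \<open>S = sinh 2\<alpha>\<close> vanishes only where \<open>\<alpha>\<close> does; in the spacelike case, if
  \<open>sin 2\<alpha>\<close> vanished on the whole interval, \<open>\<alpha>\<close> would by continuity be one fixed multiple of
  \<open>\<pi>/2\<close> (lemma \<open>sin_double_zero_imp_constant\<close>).

  The Codazzi equations themselves come from the symmetry of the second derivatives of \<open>X\<close> and \<open>N\<close>,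
  by differentiating the coefficients \<open>\<langle>N\<^sub>u, X\<^sub>u\<rangle>\<close>, \<open>\<langle>N\<^sub>u, X\<^sub>v\<rangle>\<close>, \<open>\<langle>N\<^sub>v, X\<^sub>u\<rangle>\<close>, \<open>\<langle>N\<^sub>v, X\<^sub>v\<rangle>\<close> of the
  second fundamental form in the ambient space (lemma \<open>codazzi_identity\<close>); Christoffel
  symbols enter only through the products \<open>\<langle>X\<^sub>i, X\<^sub>j\<^sub>k\<rangle>\<close> (lemma \<open>metric_derivatives\<close>).
\<close>

section \<open>Partial derivatives in the coordinates\<close>

definition du :: "(real \<times> real \<Rightarrow> 'a::real_normed_vector) \<Rightarrow> real \<times> real \<Rightarrow> 'a" where
  "du f p = frechet_derivative f (at p) (1, 0)"

definition dv :: "(real \<times> real \<Rightarrow> 'a::real_normed_vector) \<Rightarrow> real \<times> real \<Rightarrow> 'a" where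
  "dv f p = frechet_derivative f (at p) (0, 1)"

lemma smooth_on_continuous_on: "smooth_on D f \<Longrightarrow> continuous_on D f"
  by (metis smooth_on_def Ck_on.simps(1))

lemma smooth_on_differentiable: "smooth_on D f \<Longrightarrow> p \<in> D \<Longrightarrow> f differentiable (at p)"
  by (metis smooth_on_def Ck_on.simps(2))

lemma smooth_on_directional:
  "smooth_on D f \<Longrightarrow> smooth_on D (\<lambda>p. frechet_derivative f (at p) h)"
  by (metis smooth_on_def Ck_on.simps(2))

lemma smooth_on_du: "smooth_on D f \<Longrightarrow> smooth_on D (du f)"
  using smooth_on_directional[of D f "(1, 0)"] by (simp add: du_def[abs_def])

lemma smooth_on_dv: "smooth_on D f \<Longrightarrow> smooth_on D (dv f)"
  using smooth_on_directional[of D f "(0, 1)"] by (simp add: dv_def[abs_def])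

lemma has_vector_derivative_du:
  assumes "f differentiable (at (u, v))"
  shows "((\<lambda>s. f (s, v)) has_vector_derivative du f (u, v)) (at u)"
proof -
  have f: "(f has_derivative frechet_derivative f (at (u, v))) (at ((\<lambda>s. (s, v)) u))"
    using assms by (simp add: frechet_derivative_works)
  have "((\<lambda>s. (s, v)) has_derivative (\<lambda>h. (h, 0))) (at u)"
    by (auto intro!: derivative_eq_intros)
  from diff_chain_at[OF this f]
  have "((\<lambda>s. f (s, v)) has_derivative (\<lambda>h. frechet_derivative f (at (u, v)) (h, 0))) (at u)"
    by (simp add: o_def)
  moreover have "frechet_derivative f (at (u, v)) (h, 0) = h *\<^sub>R du f (u, v)" for h
    using linear_cmul[OF linear_frechet_derivative[OF assms], of h "(1, 0)"] by (simp add: du_def)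
  ultimately show ?thesis by (simp add: has_vector_derivative_def)
qed

lemma has_vector_derivative_dv:
  assumes "f differentiable (at (u, v))"
  shows "((\<lambda>t. f (u, t)) has_vector_derivative dv f (u, v)) (at v)"
proof -
  have f: "(f has_derivative frechet_derivative f (at (u, v))) (at ((\<lambda>t. (u, t)) v))"
    using assms by (simp add: frechet_derivative_works)
  have "((\<lambda>t. (u, t)) has_derivative (\<lambda>h. (0, h))) (at v)"
    by (auto intro!: derivative_eq_intros)
  from diff_chain_at[OF this f]
  have "((\<lambda>t. f (u, t)) has_derivative (\<lambda>h. frechet_derivative f (at (u, v)) (0, h))) (at v)"
    by (simp add: o_def)
  moreover have "frechet_derivative f (at (u, v)) (0, h) = h *\<^sub>R dv f (u, v)" for h
    using linear_cmul[OF linear_frechet_derivative[OF assms], of h "(0, 1)"] by (simp add: dv_def)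
  ultimately show ?thesis by (simp add: has_vector_derivative_def)
qed

text \<open>
  The mean value theorem in the first and then in the second variable. The left-hand side does not
  depend on the order of the variables, which is what forces mixed partial derivatives to agree.
\<close>

lemma second_difference_mean_value:
  fixes f :: "real \<Rightarrow> real \<Rightarrow> real"
  assumes h: "h > 0"
    and f1: "\<And>x y. a \<le> x \<Longrightarrow> x \<le> a + h \<Longrightarrow> b \<le> y \<Longrightarrow> y \<le> b + h \<Longrightarrow>
      ((\<lambda>s. f s y) has_real_derivative f1 x y) (at x)"
    and f12: "\<And>x y. a \<le> x \<Longrightarrow> x \<le> a + h \<Longrightarrow> b \<le> y \<Longrightarrow> y \<le> b + h \<Longrightarrow>
      ((\<lambda>t. f1 x t) has_real_derivative f12 x y) (at y)"
  shows "\<exists>x y. a < x \<and> x < a + h \<and> b < y \<and> y < b + h \<and>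
    f (a + h) (b + h) - f (a + h) b - f a (b + h) + f a b = h\<^sup>2 * f12 x y"
proof -
  have "\<exists>x. a < x \<and> x < a + h \<and>
      (f (a + h) (b + h) - f (a + h) b) - (f a (b + h) - f a b)
        = (a + h - a) * (f1 x (b + h) - f1 x b)"
    by (rule MVT2) (use h in \<open>auto intro!: derivative_intros f1\<close>)
  then obtain x where x: "a < x" "x < a + h"
    and eq: "(f (a + h) (b + h) - f (a + h) b) - (f a (b + h) - f a b)
      = h * (f1 x (b + h) - f1 x b)" by auto
  have "\<exists>y. b < y \<and> y < b + h \<and> f1 x (b + h) - f1 x b = (b + h - b) * f12 x y"
    by (rule MVT2) (use h x in \<open>auto intro!: f12\<close>)
  then obtain y where "b < y" "y < b + h" "f1 x (b + h) - f1 x b = h * f12 x y" by auto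
  with x eq show ?thesis by (intro exI[of _ x] exI[of _ y]) (simp add: power2_eq_square)
qed

text \<open>
  On every small square with corner \<open>(a, b)\<close>, the second difference quotient is a value of
  \<open>f12\<close> and also a value of \<open>f21\<close>; by continuity both values tend to those at \<open>(a, b)\<close>.
\<close>

lemma mixed_partial_derivatives_eq_real:
  fixes f :: "real \<Rightarrow> real \<Rightarrow> real"
  assumes D: "open D" "(a, b) \<in> D"
    and f1: "\<And>x y. (x, y) \<in> D \<Longrightarrow> ((\<lambda>s. f s y) has_real_derivative f1 x y) (at x)"
    and f12: "\<And>x y. (x, y) \<in> D \<Longrightarrow> ((\<lambda>t. f1 x t) has_real_derivative f12 (x, y)) (at y)"
    and f2: "\<And>x y. (x, y) \<in> D \<Longrightarrow> ((\<lambda>t. f x t) has_real_derivative f2 x y) (at y)"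
    and f21: "\<And>x y. (x, y) \<in> D \<Longrightarrow> ((\<lambda>s. f2 s y) has_real_derivative f21 (x, y)) (at x)"
    and cont: "continuous_on D f12" "continuous_on D f21"
  shows "f12 (a, b) = f21 (a, b)"
proof (rule ccontr)
  assume neq: "f12 (a, b) \<noteq> f21 (a, b)"
  define e where "e = \<bar>f12 (a, b) - f21 (a, b)\<bar> / 2"
  have e: "e > 0" using neq by (simp add: e_def)
  have "isCont f12 (a, b)" "isCont f21 (a, b)"
    using cont D by (auto simp: continuous_on_eq_continuous_at)
  then have "\<exists>r>0. \<forall>q. dist q (a, b) < r \<longrightarrow> dist (f12 q) (f12 (a, b)) < e"
    and "\<exists>r>0. \<forall>q. dist q (a, b) < r \<longrightarrow> dist (f21 q) (f21 (a, b)) < e"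
    using e by (simp_all add: continuous_at_eps_delta)
  then obtain r1 r2 where r: "r1 > 0" "r2 > 0"
    and r1: "\<And>q. dist q (a, b) < r1 \<Longrightarrow> dist (f12 q) (f12 (a, b)) < e"
    and r2: "\<And>q. dist q (a, b) < r2 \<Longrightarrow> dist (f21 q) (f21 (a, b)) < e"
    by blast
  have "\<exists>r>0. \<forall>q. dist q (a, b) < r \<longrightarrow> q \<in> D"
    using D unfolding open_dist by (rule bspec)
  then obtain r3 where r3: "r3 > 0" "\<And>q. dist q (a, b) < r3 \<Longrightarrow> q \<in> D" by blast
  define h where "h = min r1 (min r2 r3) / 3"
  have h: "h > 0" "2 * h < r1" "2 * h < r2" "2 * h < r3"
    using r r3(1) by (auto simp: h_def)
  have near: "dist (x, y) (a, b) \<le> 2 * h" if "a \<le> x" "x \<le> a + h" "b \<le> y" "y \<le> b + h" for x y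
  proof -
    have "dist (x, y) (a, b) \<le> \<bar>x - a\<bar> + \<bar>y - b\<bar>"
      by (simp add: dist_Pair_Pair dist_real_def sqrt_sum_squares_le_sum_abs)
    then show ?thesis using that by auto
  qed
  have inD: "(x, y) \<in> D" if "a \<le> x" "x \<le> a + h" "b \<le> y" "y \<le> b + h" for x y
    using near[OF that] h(4) r3(2) by force
  have "\<exists>x y. a < x \<and> x < a + h \<and> b < y \<and> y < b + h \<and>
      f (a + h) (b + h) - f (a + h) b - f a (b + h) + f a b = h\<^sup>2 * f12 (x, y)"
    by (rule second_difference_mean_value[where ?f1.0 = f1 and ?f12.0 = "\<lambda>x y. f12 (x, y)"])
      (use h in \<open>auto intro!: f1 f12 inD\<close>)
  then obtain x y where xy: "a < x" "x < a + h" "b < y" "y < b + h"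
    "f (a + h) (b + h) - f (a + h) b - f a (b + h) + f a b = h\<^sup>2 * f12 (x, y)" by auto
  (* The same second difference, with the two variables exchanged. *)
  have "\<exists>y x. b < y \<and> y < b + h \<and> a < x \<and> x < a + h \<and>
      f (a + h) (b + h) - f a (b + h) - f (a + h) b + f a b = h\<^sup>2 * f21 (x, y)"
    by (rule second_difference_mean_value[where f = "\<lambda>y x. f x y" and ?f1.0 = "\<lambda>y x. f2 x y"
          and ?f12.0 = "\<lambda>y x. f21 (x, y)"])
      (use h in \<open>auto intro!: f2 f21 inD\<close>)
  then obtain x' y' where xy': "a < x'" "x' < a + h" "b < y'" "y' < b + h"
    "f (a + h) (b + h) - f a (b + h) - f (a + h) b + f a b = h\<^sup>2 * f21 (x', y')" by auto
  have "h\<^sup>2 * f12 (x, y) = h\<^sup>2 * f21 (x', y')" using xy(5) xy'(5) by linarith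
  then have "f12 (x, y) = f21 (x', y')" using h(1) by simp
  moreover have "dist (f12 (x, y)) (f12 (a, b)) < e"
    using near[of x y] xy h by (intro r1) auto
  moreover have "dist (f21 (x', y')) (f21 (a, b)) < e"
    using near[of x' y'] xy' h by (intro r2) auto
  moreover have "dist (f12 (a, b)) (f21 (a, b)) = 2 * e" by (simp add: e_def dist_real_def)
  ultimately show False
    using dist_triangle[of "f12 (a, b)" "f21 (a, b)" "f12 (x, y)"]
    by (simp add: dist_commute)
qed

lemma du_dv_commute:
  fixes f :: "real \<times> real \<Rightarrow> real^'n"
  assumes D: "open D" "p \<in> D" and f: "smooth_on D f"
  shows "dv (du f) p = du (dv f) p"
proof -
  have nth: "((\<lambda>x. g x $ i) has_real_derivative g' $ i) F"
    if "(g has_vector_derivative g') F" for g :: "real \<Rightarrow> real^'n" and g' F i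
    using bounded_linear.has_vector_derivative[OF bounded_linear_vec_nth that]
    by (simp add: has_real_derivative_iff_has_vector_derivative)
  obtain a b where p: "p = (a, b)" by fastforce
  have "dv (du f) (a, b) $ i = du (dv f) (a, b) $ i" for i
  proof (rule mixed_partial_derivatives_eq_real[where D = D and f = "\<lambda>x y. f (x, y) $ i"
        and ?f1.0 = "\<lambda>x y. du f (x, y) $ i" and ?f2.0 = "\<lambda>x y. dv f (x, y) $ i"
        and ?f12.0 = "\<lambda>p. dv (du f) p $ i" and ?f21.0 = "\<lambda>p. du (dv f) p $ i"])
    show "continuous_on D (\<lambda>p. dv (du f) p $ i)" "continuous_on D (\<lambda>p. du (dv f) p $ i)"
      using smooth_on_dv[OF smooth_on_du[OF f]] smooth_on_du[OF smooth_on_dv[OF f]]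
      by - (intro continuous_on_component smooth_on_continuous_on; assumption)+
  qed (use D f p in \<open>auto intro!: nth has_vector_derivative_du has_vector_derivative_dv
      smooth_on_differentiable smooth_on_du smooth_on_dv\<close>)
  then show ?thesis by (simp add: p vec_eq_iff)
qed

section \<open>Derivatives of Lorentzian products\<close>

lemma bilinear_lorentz: "bilinear lorentz"
  unfolding bilinear_def linear_iff by (auto simp: lorentz_def algebra_simps)

lemma lorentz_simps:
  "lorentz (x + y) z = lorentz x z + lorentz y z"
  "lorentz z (x + y) = lorentz z x + lorentz z y"
  "lorentz (x - y) z = lorentz x z - lorentz y z"
  "lorentz z (x - y) = lorentz z x - lorentz z y"
  "lorentz (- x) z = - lorentz x z"
  "lorentz z (- x) = - lorentz z x"
  "lorentz (r *\<^sub>R x) z = r * lorentz x z"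
  "lorentz z (r *\<^sub>R x) = r * lorentz z x"
  by (simp_all add: lorentz_def algebra_simps)

lemma lorentz_commute: "lorentz x y = lorentz y x"
  by (simp add: lorentz_def mult.commute)

lemma has_real_derivative_lorentz:
  assumes "(f has_vector_derivative f') (at t)" "(g has_vector_derivative g') (at t)"
  shows "((\<lambda>t. lorentz (f t) (g t)) has_real_derivative lorentz (f t) g' + lorentz f' (g t)) (at t)"
proof -
  have "bounded_bilinear lorentz"
    using bilinear_lorentz by (simp add: bilinear_conv_bounded_bilinear)
  from bounded_bilinear.has_vector_derivative[OF this assms] show ?thesis
    by (simp add: has_real_derivative_iff_has_vector_derivative)
qed

lemma lorentz_has_derivative_du:
  assumes "smooth_on D Y" "smooth_on D Z" "(u, v) \<in> D"
  shows "((\<lambda>s. lorentz (Y (s, v)) (Z (s, v))) has_real_derivative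
    lorentz (Y (u, v)) (du Z (u, v)) + lorentz (du Y (u, v)) (Z (u, v))) (at u)"
  using assms by (intro has_real_derivative_lorentz has_vector_derivative_du smooth_on_differentiable)

lemma lorentz_has_derivative_dv:
  assumes "smooth_on D Y" "smooth_on D Z" "(u, v) \<in> D"
  shows "((\<lambda>t. lorentz (Y (u, t)) (Z (u, t))) has_real_derivative
    lorentz (Y (u, v)) (dv Z (u, v)) + lorentz (dv Y (u, v)) (Z (u, v))) (at v)"
  using assms by (intro has_real_derivative_lorentz has_vector_derivative_dv smooth_on_differentiable)

text \<open>
  For the shape operator this is the Codazzi equation: on the left the products are differentiated,
  and the terms with \<open>N\<^sub>u\<^sub>v\<close> and \<open>N\<^sub>v\<^sub>u\<close> cancel. It is applied with \<open>Y = X\<^sub>u\<close> and \<open>Y = X\<^sub>v\<close>.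
\<close>

lemma codazzi_identity:
  assumes D: "open D" "(u, v) \<in> D" and N: "smooth_on D N" and Y: "smooth_on D Y"
    and A: "((\<lambda>t. lorentz (du N (u, t)) (Y (u, t))) has_real_derivative A) (at v)"
    and B: "((\<lambda>s. lorentz (dv N (s, v)) (Y (s, v))) has_real_derivative B) (at u)"
  shows "A - B = lorentz (du N (u, v)) (dv Y (u, v)) - lorentz (dv N (u, v)) (du Y (u, v))"
proof -
  note dA = DERIV_unique[OF A lorentz_has_derivative_dv[OF smooth_on_du[OF N] Y D(2)]]
  note dB = DERIV_unique[OF B lorentz_has_derivative_du[OF smooth_on_dv[OF N] Y D(2)]]
  show ?thesis using dA dB du_dv_commute[OF D N] by simp
qed

section \<open>The Codazzi equations of a twisted surface\<close>

text \<open>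
  The spacelike and the timelike case are treated together through the sign \<open>\<delta> * \<epsilon>\<close>, which is
  \<open>1\<close> for a Riemannian and \<open>-1\<close> for a Lorentzian metric. The functions \<open>C\<close> and \<open>S\<close> stand for
  the circular or hyperbolic cosine and sine of twice the twist, and \<open>\<theta>\<close> for the derivative of the
  twist; \<open>h\<close> and \<open>w\<close> are the half sum and half difference of the principal curvatures. A twist
  is defined with arbitrary functions \<open>\<lambda>\<^sub>1\<close>, \<open>\<lambda>\<^sub>2\<close>, so the differentiability of \<open>h\<close> and
  \<open>\<rho>\<^sup>2 w\<close> is a conclusion (\<open>differentiable_curvature_data\<close>).
\<close>

locale twisted_surface =
  fixes X N :: "real \<times> real \<Rightarrow> real^3" and I J :: "real set"
    and \<rho> \<rho>' h w C S \<theta> :: "real \<Rightarrow> real" and \<delta> \<epsilon> :: real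
  assumes I: "open I" "connected I" and J: "open J"
    and X: "smooth_on (I \<times> J) X" and N: "smooth_on (I \<times> J) N"
    and sgn: "\<delta> * \<delta> = 1" "\<epsilon> * \<epsilon> = 1"
    and \<rho>: "\<And>u. u \<in> I \<Longrightarrow> (\<rho> has_real_derivative \<rho>' u) (at u)"
    and \<rho>_pos: "\<And>u. u \<in> I \<Longrightarrow> \<rho> u > 0"
    and E: "\<And>u v. u \<in> I \<Longrightarrow> v \<in> J \<Longrightarrow> lorentz (du X (u, v)) (du X (u, v)) = \<delta> * (\<rho> u)\<^sup>2"
    and F: "\<And>u v. u \<in> I \<Longrightarrow> v \<in> J \<Longrightarrow> lorentz (du X (u, v)) (dv X (u, v)) = 0"
    and G: "\<And>u v. u \<in> I \<Longrightarrow> v \<in> J \<Longrightarrow> lorentz (dv X (u, v)) (dv X (u, v)) = \<epsilon> * (\<rho> u)\<^sup>2"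
    and Nu: "\<And>u v. u \<in> I \<Longrightarrow> v \<in> J \<Longrightarrow>
      du N (u, v) = - ((h u + w u * C v) *\<^sub>R du X (u, v) - (w u * S v) *\<^sub>R dv X (u, v))"
    and Nv: "\<And>u v. u \<in> I \<Longrightarrow> v \<in> J \<Longrightarrow>
      dv N (u, v) = - (- (\<delta> * \<epsilon> * w u * S v) *\<^sub>R du X (u, v) + (h u - w u * C v) *\<^sub>R dv X (u, v))"
    and C: "\<And>v. v \<in> J \<Longrightarrow> (C has_real_derivative - (\<delta> * \<epsilon> * 2 * \<theta> v * S v)) (at v)"
    and S: "\<And>v. v \<in> J \<Longrightarrow> (S has_real_derivative 2 * \<theta> v * C v) (at v)"
    and CS: "\<And>v. v \<in> J \<Longrightarrow> (C v)\<^sup>2 + \<delta> * \<epsilon> * (S v)\<^sup>2 = 1"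
begin

text \<open>
  The combination \<open>w' + 2 (\<rho>'/\<rho>) w\<close> in the Codazzi equations is \<open>P' / \<rho>\<^sup>2\<close> for this weighted
  half difference; the weight absorbs the Christoffel symbols.
\<close>

definition P :: "real \<Rightarrow> real" where "P u = (\<rho> u)\<^sup>2 * w u"

lemma smooth_dX: "smooth_on (I \<times> J) (du X)" "smooth_on (I \<times> J) (dv X)"
  using X by (auto intro: smooth_on_du smooth_on_dv)

lemma smooth_dN: "smooth_on (I \<times> J) (du N)" "smooth_on (I \<times> J) (dv N)"
  using N by (auto intro: smooth_on_du smooth_on_dv)

lemma open_dom: "open (I \<times> J)"
  using I J by (simp add: open_Times)

lemma F': "u \<in> I \<Longrightarrow> v \<in> J \<Longrightarrow> lorentz (dv X (u, v)) (du X (u, v)) = 0"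
  using F lorentz_commute by metis

lemma second_form:
  assumes "u \<in> I" "v \<in> J"
  shows "lorentz (du N (u, v)) (du X (u, v)) = - \<delta> * ((\<rho> u)\<^sup>2 * h u + P u * C v)"
    and "lorentz (du N (u, v)) (dv X (u, v)) = \<epsilon> * (P u * S v)"
    and "lorentz (dv N (u, v)) (du X (u, v)) = \<epsilon> * (P u * S v)"
    and "lorentz (dv N (u, v)) (dv X (u, v)) = - \<epsilon> * ((\<rho> u)\<^sup>2 * h u - P u * C v)"
proof -
  have "\<delta> * \<epsilon> * w u * S v * (\<delta> * (\<rho> u)\<^sup>2) = (\<delta> * \<delta>) * (\<epsilon> * w u * S v * (\<rho> u)\<^sup>2)" by simp
  then show "lorentz (dv N (u, v)) (du X (u, v)) = \<epsilon> * (P u * S v)"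
    using assms sgn by (simp add: Nv lorentz_simps E F F' P_def)
qed (use assms in \<open>simp_all add: Nu Nv lorentz_simps E F F' G P_def algebra_simps\<close>)

text \<open>
  The Christoffel symbols of the first kind of the metric \<open>\<rho>\<^sup>2 (\<delta> du\<^sup>2 + \<epsilon> dv\<^sup>2)\<close>, read off from
  the derivatives of its three coefficients.
\<close>

lemma metric_derivatives:
  assumes u: "u \<in> I" and v: "v \<in> J"
  shows "lorentz (du X (u, v)) (du (du X) (u, v)) = \<delta> * (\<rho> u * \<rho>' u)"
    and "lorentz (dv X (u, v)) (du (dv X) (u, v)) = \<epsilon> * (\<rho> u * \<rho>' u)"
    and "lorentz (du X (u, v)) (du (dv X) (u, v)) = 0"
    and "lorentz (dv X (u, v)) (dv (dv X) (u, v)) = 0"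
    and "lorentz (dv X (u, v)) (du (du X) (u, v)) = 0"
    and "lorentz (du X (u, v)) (dv (dv X) (u, v)) = - \<epsilon> * (\<rho> u * \<rho>' u)"
proof -
  have uv: "(u, v) \<in> I \<times> J" using u v by simp
  have \<rho>2: "((\<lambda>s. c * (\<rho> s)\<^sup>2) has_real_derivative 2 * (c * (\<rho> u * \<rho>' u))) (at u)" for c
    using \<rho>[OF u] by (auto intro!: derivative_eq_intros)
  have along_u: "a = b" if "(f has_real_derivative a) (at u)" "(g has_real_derivative b) (at u)"
    "\<And>s. s \<in> I \<Longrightarrow> f s = g s" for f g a b
    using has_field_derivative_transform_within_open[OF that(1) I(1) u that(3)] that(2)
    by (rule DERIV_unique)
  have along_v: "a = b" if "(f has_real_derivative a) (at v)" "(g has_real_derivative b) (at v)"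
    "\<And>t. t \<in> J \<Longrightarrow> f t = g t" for f g a b
    using has_field_derivative_transform_within_open[OF that(1) J v that(3)] that(2)
    by (rule DERIV_unique)
  have mix: "dv (du X) (u, v) = du (dv X) (u, v)"
    by (rule du_dv_commute[OF open_dom uv X])
  show uu: "lorentz (du X (u, v)) (du (du X) (u, v)) = \<delta> * (\<rho> u * \<rho>' u)"
    using along_u[OF lorentz_has_derivative_du[OF smooth_dX(1) smooth_dX(1) uv] \<rho>2[of \<delta>]] E v
    by (simp add: lorentz_commute)
  show uv1: "lorentz (dv X (u, v)) (du (dv X) (u, v)) = \<epsilon> * (\<rho> u * \<rho>' u)"
    using along_u[OF lorentz_has_derivative_du[OF smooth_dX(2) smooth_dX(2) uv] \<rho>2[of \<epsilon>]] G v
    by (simp add: lorentz_commute)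
  show uv2: "lorentz (du X (u, v)) (du (dv X) (u, v)) = 0"
    using along_v[OF lorentz_has_derivative_dv[OF smooth_dX(1) smooth_dX(1) uv] DERIV_const[of "\<delta> * (\<rho> u)\<^sup>2"]] E u
    by (simp add: lorentz_commute mix)
  show "lorentz (dv X (u, v)) (dv (dv X) (u, v)) = 0"
    using along_v[OF lorentz_has_derivative_dv[OF smooth_dX(2) smooth_dX(2) uv] DERIV_const[of "\<epsilon> * (\<rho> u)\<^sup>2"]] G u
    by (simp add: lorentz_commute)
  show "lorentz (dv X (u, v)) (du (du X) (u, v)) = 0"
    using along_u[OF lorentz_has_derivative_du[OF smooth_dX(1) smooth_dX(2) uv] DERIV_const[of 0]] F v uv2
    by (simp add: lorentz_commute)
  show "lorentz (du X (u, v)) (dv (dv X) (u, v)) = - \<epsilon> * (\<rho> u * \<rho>' u)"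
    using along_v[OF lorentz_has_derivative_dv[OF smooth_dX(1) smooth_dX(2) uv] DERIV_const[of 0]] F u uv1
    by (simp add: lorentz_commute mix)
qed

text \<open>
  For fixed \<open>v\<close> the coefficients of the second fundamental form are smooth in \<open>u\<close>. They are linear
  in \<open>\<rho>\<^sup>2 h\<close>, \<open>P C\<close> and \<open>P S\<close>, and \<open>P\<close> is recovered from the last two because
  \<open>C\<^sup>2 + \<delta> \<epsilon> S\<^sup>2 = 1\<close>.
\<close>

lemma differentiable_curvature_data:
  assumes u: "u \<in> I" and v: "v \<in> J"
  shows "\<exists>P' h'. (P has_real_derivative P') (at u) \<and> (h has_real_derivative h') (at u)"
proof -
  have uv: "(u, v) \<in> I \<times> J" using u v by simp
  define L where "L s = lorentz (du N (s, v)) (du X (s, v))" for s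
  define M where "M s = lorentz (dv N (s, v)) (du X (s, v))" for s
  define K where "K s = lorentz (dv N (s, v)) (dv X (s, v))" for s
  obtain L' M' K' where d: "(L has_real_derivative L') (at u)" "(M has_real_derivative M') (at u)"
    "(K has_real_derivative K') (at u)"
    unfolding L_def M_def K_def
    using lorentz_has_derivative_du[OF smooth_dN(1) smooth_dX(1) uv] lorentz_has_derivative_du[OF smooth_dN(2) smooth_dX(1) uv]
      lorentz_has_derivative_du[OF smooth_dN(2) smooth_dX(2) uv] by blast
  have LK: "\<delta> * L s = - ((\<rho> s)\<^sup>2 * h s + P s * C v)" "\<epsilon> * M s = P s * S v"
     "\<epsilon> * K s = - ((\<rho> s)\<^sup>2 * h s - P s * C v)" if "s \<in> I" for s
    using second_form[OF that v] sgn unfolding L_def M_def K_def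
    by (simp_all flip: mult.assoc)
  have P: "C v * ((\<epsilon> * K s - \<delta> * L s) / 2) + \<delta> * \<epsilon> * S v * (\<epsilon> * M s) = P s" if "s \<in> I" for s
  proof -
    have "C v * ((\<epsilon> * K s - \<delta> * L s) / 2) + \<delta> * \<epsilon> * S v * (\<epsilon> * M s)
        = P s * ((C v)\<^sup>2 + \<delta> * \<epsilon> * (S v)\<^sup>2)"
      unfolding LK[OF that] by (simp add: algebra_simps power2_eq_square)
    then show ?thesis using CS[OF v] by simp
  qed
  have h: "- (\<epsilon> * K s + \<delta> * L s) / (2 * (\<rho> s)\<^sup>2) = h s" if "s \<in> I" for s
    unfolding LK[OF that] using \<rho>_pos[OF that] by (simp add: field_simps)
  have diff: "L differentiable (at u)" "M differentiable (at u)" "K differentiable (at u)"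
    "\<rho> differentiable (at u)"
    using d \<rho>[OF u] by (auto simp: real_differentiable_def)
  have "(\<lambda>s. C v * ((\<epsilon> * K s - \<delta> * L s) / 2) + \<delta> * \<epsilon> * S v * (\<epsilon> * M s)) differentiable (at u)"
    using diff by (intro derivative_intros) auto
  moreover have "(\<lambda>s. - (\<epsilon> * K s + \<delta> * L s) / (2 * (\<rho> s)\<^sup>2)) differentiable (at u)"
    using diff \<rho>_pos[OF u] by (intro derivative_intros) auto
  ultimately show ?thesis
    using has_field_derivative_transform_within_open[where g = P, OF _ I(1) u P]
      has_field_derivative_transform_within_open[where g = h, OF _ I(1) u h]
    unfolding real_differentiable_def by blast
qed

text \<open>
  The terms with \<open>\<rho>'\<close> disappear: in the first equation the two Christoffel contributions cancel,
  and in the second they add up to \<open>2 \<rho> \<rho>' h\<close>, which is the part of \<open>(\<rho>\<^sup>2 h)'\<close> not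
  involving \<open>h'\<close>.
\<close>

lemma codazzi_twist:
  assumes u: "u \<in> I" and v: "v \<in> J"
    and P': "(P has_real_derivative P') (at u)" and h': "(h has_real_derivative h') (at u)"
  shows "S v * (P' - 2 * \<theta> v * P u) = 0"
    and "C v * (P' - 2 * \<theta> v * P u) = (\<rho> u)\<^sup>2 * h'"
proof -
  have uv: "(u, v) \<in> I \<times> J" using u v by simp
  have mix: "dv (du X) (u, v) = du (dv X) (u, v)"
    by (rule du_dv_commute[OF open_dom uv X])
  have sgn': "\<delta> * (\<delta> * x) = x" "\<epsilon> * (\<epsilon> * x) = x" for x
    using sgn by (simp_all flip: mult.assoc)
  have nz: "\<delta> \<noteq> 0" "\<epsilon> \<noteq> 0" using sgn by auto
  have "((\<lambda>t. - \<delta> * ((\<rho> u)\<^sup>2 * h u + P u * C t)) has_real_derivative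
      \<epsilon> * (2 * \<theta> v * P u * S v)) (at v)"
    using C[OF v] sgn by (auto intro!: derivative_eq_intros simp: sgn' algebra_simps)
  then have Lv: "((\<lambda>t. lorentz (du N (u, t)) (du X (u, t))) has_real_derivative
      \<epsilon> * (2 * \<theta> v * P u * S v)) (at v)"
    by (rule has_field_derivative_transform_within_open[OF _ J v]) (simp add: second_form u)
  have "((\<lambda>s. \<epsilon> * (P s * S v)) has_real_derivative \<epsilon> * (P' * S v)) (at u)"
    using P' by (auto intro!: derivative_eq_intros)
  then have Mu: "((\<lambda>s. lorentz (dv N (s, v)) (du X (s, v))) has_real_derivative \<epsilon> * (P' * S v)) (at u)"
    by (rule has_field_derivative_transform_within_open[OF _ I(1) u]) (simp add: second_form v)
  have "((\<lambda>t. \<epsilon> * (P u * S t)) has_real_derivative \<epsilon> * (P u * (2 * \<theta> v * C v))) (at v)"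
    using S[OF v] by (auto intro!: derivative_eq_intros)
  then have Mv: "((\<lambda>t. lorentz (du N (u, t)) (dv X (u, t))) has_real_derivative
      \<epsilon> * (P u * (2 * \<theta> v * C v))) (at v)"
    by (rule has_field_derivative_transform_within_open[OF _ J v]) (simp add: second_form u)
  have "((\<lambda>s. - \<epsilon> * ((\<rho> s)\<^sup>2 * h s - P s * C v)) has_real_derivative
      - \<epsilon> * ((\<rho> u)\<^sup>2 * h' + 2 * \<rho> u * \<rho>' u * h u - P' * C v)) (at u)"
    using P' h' \<rho>[OF u] by (auto intro!: derivative_eq_intros simp: algebra_simps)
  then have Ku: "((\<lambda>s. lorentz (dv N (s, v)) (dv X (s, v))) has_real_derivative
      - \<epsilon> * ((\<rho> u)\<^sup>2 * h' + 2 * \<rho> u * \<rho>' u * h u - P' * C v)) (at u)"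
    by (rule has_field_derivative_transform_within_open[OF _ I(1) u]) (simp add: second_form v)
  have "\<epsilon> * (2 * \<theta> v * P u * S v) - \<epsilon> * (P' * S v) = 0"
    using codazzi_identity[OF open_dom uv N smooth_dX(1) Lv Mu] u v
    by (simp add: mix Nu Nv lorentz_simps metric_derivatives sgn' algebra_simps)
  then have "\<epsilon> * (S v * (P' - 2 * \<theta> v * P u)) = 0" by argo
  then show "S v * (P' - 2 * \<theta> v * P u) = 0" using nz by simp
  have "\<epsilon> * (P u * (2 * \<theta> v * C v)) - - \<epsilon> * ((\<rho> u)\<^sup>2 * h' + 2 * \<rho> u * \<rho>' u * h u - P' * C v)
      = \<epsilon> * (2 * h u * \<rho> u * \<rho>' u)"
    using codazzi_identity[OF open_dom uv N smooth_dX(2) Mv Ku] u v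
    by (simp add: mix Nu Nv lorentz_simps metric_derivatives sgn' algebra_simps)
  then have "\<epsilon> * (C v * (P' - 2 * \<theta> v * P u)) = \<epsilon> * ((\<rho> u)\<^sup>2 * h')"
    by (simp add: algebra_simps)
  then show "C v * (P' - 2 * \<theta> v * P u) = (\<rho> u)\<^sup>2 * h'" using nz by simp
qed

text \<open>
  The value \<open>v1\<close> serves to show \<open>h' = 0\<close>; afterwards the Codazzi equations at an arbitrary \<open>v\<close> and
  the fixed \<open>u0\<close> express \<open>\<theta> v\<close> by quantities that depend on \<open>u0\<close> alone.
\<close>

lemma rigidity:
  assumes v1: "v1 \<in> J" "S v1 \<noteq> 0" and u0: "u0 \<in> I" "w u0 \<noteq> 0"
  shows "\<exists>c. \<forall>u\<in>I. h u = c" and "\<exists>a. \<forall>v\<in>J. \<theta> v = a"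
proof -
  have h0: "(h has_real_derivative 0) (at u)" if u: "u \<in> I" for u
  proof -
    obtain P' h' where d: "(P has_real_derivative P') (at u)" "(h has_real_derivative h') (at u)"
      using differentiable_curvature_data[OF u v1(1)] by blast
    have "P' - 2 * \<theta> v1 * P u = 0" using codazzi_twist(1)[OF u v1(1) d] v1(2) by simp
    then have "(\<rho> u)\<^sup>2 * h' = 0" using codazzi_twist(2)[OF u v1(1) d] by simp
    then have "h' = 0" using \<rho>_pos[OF u] by simp
    then show ?thesis using d by simp
  qed
  show "\<exists>c. \<forall>u\<in>I. h u = c"
    using has_field_derivative_0_imp_constant_on[of I h] h0 I unfolding constant_on_def by blast
  obtain P' h' where d: "(P has_real_derivative P') (at u0)" "(h has_real_derivative h') (at u0)"
    using differentiable_curvature_data[OF u0(1) v1(1)] by blast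
  have h'0: "h' = 0" using DERIV_unique[OF d(2) h0[OF u0(1)]] .
  have P0: "P u0 \<noteq> 0" using u0 \<rho>_pos[of u0] by (simp add: P_def)
  have "\<theta> v = P' / (2 * P u0)" if v: "v \<in> J" for v
  proof -
    have "C v \<noteq> 0 \<or> S v \<noteq> 0" using CS[OF v] by auto
    then have "P' - 2 * \<theta> v * P u0 = 0"
      using codazzi_twist[OF u0(1) v d] h'0 by auto
    then show ?thesis using P0 by (simp add: field_simps)
  qed
  then show "\<exists>a. \<forall>v\<in>J. \<theta> v = a" by blast
qed

end

section \<open>From coordinates to twisted surfaces\<close>

lemma frechet_derivative_coordinates:
  assumes "f differentiable (at p)"
  shows "frechet_derivative f (at p) (a, b) = a *\<^sub>R du f p + b *\<^sub>R dv f p"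
proof -
  note lin = linear_frechet_derivative[OF assms]
  have "(a, b) = a *\<^sub>R (1, 0) + b *\<^sub>R (0, 1)" by simp
  then show ?thesis
    by (simp only: linear_add[OF lin] linear_cmul[OF lin] du_def dv_def)
qed

lemma tangent_map_coordinates:
  assumes "X differentiable (at p)"
  shows "tangent_map X p (a, b) = a *\<^sub>R du X p + b *\<^sub>R dv X p"
  unfolding tangent_map_def by (rule frechet_derivative_coordinates[OF assms])

text \<open>Polarization: the values of the quadratic form at \<open>(1, 0)\<close>, \<open>(0, 1)\<close> and \<open>(1, 1)\<close> suffice.\<close>

lemma metric_coefficients:
  assumes X: "X differentiable (at p)"
    and q: "\<And>a b. first_fundamental_form X p (a, b) (a, b) = r * (\<delta> * a\<^sup>2 + \<epsilon> * b\<^sup>2)"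
  shows "lorentz (du X p) (du X p) = \<delta> * r" "lorentz (du X p) (dv X p) = 0"
    "lorentz (dv X p) (dv X p) = \<epsilon> * r"
  using q[of 1 0] q[of 0 1] q[of 1 1]
  by (simp_all add: first_fundamental_form_def tangent_map_coordinates[OF X] lorentz_simps
      lorentz_commute[of "dv X p" "du X p"] algebra_simps)

lemma unit_normal_orthogonal_derivative:
  assumes D: "open D" "(u, v) \<in> D" and N: "unit_normal_field X N D"
  shows "lorentz (du N (u, v)) (N (u, v)) = 0" "lorentz (dv N (u, v)) (N (u, v)) = 0"
proof -
  have sN: "smooth_on D N" and unit: "\<And>p. p \<in> D \<Longrightarrow> lorentz (N p) (N p) = - causal_sign X D"
    using N by (auto simp: unit_normal_field_def)
  obtain A B where AB: "open A" "u \<in> A" "open B" "v \<in> B" "A \<times> B \<subseteq> D"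
    using D by (metis open_prod_elim mem_Sigma_iff)
  have "((\<lambda>s. - causal_sign X D) has_real_derivative
      lorentz (N (u, v)) (du N (u, v)) + lorentz (du N (u, v)) (N (u, v))) (at u)"
    using lorentz_has_derivative_du[OF sN sN D(2)]
    by (rule has_field_derivative_transform_within_open[OF _ AB(1,2)]) (use AB unit in auto)
  from DERIV_unique[OF this DERIV_const]
  show "lorentz (du N (u, v)) (N (u, v)) = 0" by (simp add: lorentz_commute)
  have "((\<lambda>t. - causal_sign X D) has_real_derivative
      lorentz (N (u, v)) (dv N (u, v)) + lorentz (dv N (u, v)) (N (u, v))) (at v)"
    using lorentz_has_derivative_dv[OF sN sN D(2)]
    by (rule has_field_derivative_transform_within_open[OF _ AB(3,4)]) (use AB unit in auto)
  from DERIV_unique[OF this DERIV_const]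
  show "lorentz (dv N (u, v)) (N (u, v)) = 0" by (simp add: lorentz_commute)
qed

text \<open>
  As \<open>N\<close> has constant length, its derivatives are already tangent, and the projection in the
  definition of the Weingarten endomorphism does nothing.
\<close>

lemma weingarten_coordinates:
  assumes D: "open D" "p \<in> D" and N: "unit_normal_field X N D"
  shows "weingarten N p (a, b) = - (a *\<^sub>R du N p + b *\<^sub>R dv N p)"
proof -
  have "N differentiable (at p)"
    using N D by (auto simp: unit_normal_field_def intro: smooth_on_differentiable)
  moreover have "lorentz (a *\<^sub>R du N p + b *\<^sub>R dv N p) (N p) = 0"
    using unit_normal_orthogonal_derivative[OF D(1) _ N, of "fst p" "snd p"] D(2)
    by (simp add: lorentz_simps)
  ultimately show ?thesis
    by (simp add: weingarten_def tangential_part_def frechet_derivative_coordinates)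
qed

text \<open>
  The trace is the sum of the eigenvalues. This is what makes the mean curvature well defined: the
  principal curvatures themselves are determined only up to order.
\<close>

lemma principal_curvatures_sum:
  assumes D: "open D" "p \<in> D" and N: "unit_normal_field X N D"
    and X: "X differentiable (at p)" "inj (tangent_map X p)"
    and M: "is_weingarten_matrix X N p M" and k: "principal_curvatures X N p l1 l2"
  shows "l1 + l2 = M $ 1 $ 1 + M $ 2 $ 2"
proof -
  obtain \<xi> \<eta> where ne: "\<xi> \<noteq> \<eta>" and ind: "independent {\<xi>, \<eta>}"
    and ev: "weingarten N p \<xi> = l1 *\<^sub>R tangent_map X p \<xi>"
      "weingarten N p \<eta> = l2 *\<^sub>R tangent_map X p \<eta>"
    using k unfolding principal_curvatures_def by blast
  have eigen: "M $ 1 $ 1 * a + M $ 1 $ 2 * b = l * a" "M $ 2 $ 1 * a + M $ 2 $ 2 * b = l * b"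
    if "weingarten N p (a, b) = l *\<^sub>R tangent_map X p (a, b)" for a b l
  proof -
    have "weingarten N p (a, b) = a *\<^sub>R weingarten N p (1, 0) + b *\<^sub>R weingarten N p (0, 1)"
      by (simp add: weingarten_coordinates[OF D N])
    also have "\<dots> = tangent_map X p (M $ 1 $ 1 * a + M $ 1 $ 2 * b, M $ 2 $ 1 * a + M $ 2 $ 2 * b)"
      using M by (simp add: is_weingarten_matrix_def tangent_map_coordinates[OF X(1)] algebra_simps)
    also have "weingarten N p (a, b) = tangent_map X p (l * a, l * b)"
      by (simp add: that tangent_map_coordinates[OF X(1)] algebra_simps)
    finally show "M $ 1 $ 1 * a + M $ 1 $ 2 * b = l * a" "M $ 2 $ 1 * a + M $ 2 $ 2 * b = l * b"
      using X(2) by (auto dest: injD)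
  qed
  obtain a b c d where ab: "\<xi> = (a, b)" "\<eta> = (c, d)" by fastforce
  have det: "a * d - b * c \<noteq> 0"
  proof
    assume 0: "a * d - b * c = 0"
    have "\<xi> \<notin> span {\<eta>}" "\<eta> \<noteq> 0"
      using ind ne by (auto simp: independent_insert)
    moreover have "\<xi> = (a / c) *\<^sub>R \<eta>" if "c \<noteq> 0"
      using that 0 by (simp add: ab field_simps)
    moreover have "\<xi> = (b / d) *\<^sub>R \<eta>" if "d \<noteq> 0"
      using that 0 by (simp add: ab field_simps)
    ultimately show False
      using ab(2) by (metis span_base span_scale singletonI zero_prod_def)
  qed
  (* Cramer's rule for each eigenvector equation, with the common determinant as a factor. *)
  have "(l1 + l2) * (a * d - b * c) = d * (l1 * a) - c * (l1 * b) + a * (l2 * d) - b * (l2 * c)"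
    by (simp add: algebra_simps)
  also have "\<dots> = (M $ 1 $ 1 + M $ 2 $ 2) * (a * d - b * c)"
    using eigen[of a b l1] eigen[of c d l2] ev unfolding ab
    by (simp flip: eigen) (simp add: algebra_simps)
  finally show ?thesis using det by simp
qed

lemma mean_curvature_eq:
  assumes D: "open D" "p \<in> D" and N: "unit_normal_field X N D"
    and X: "X differentiable (at p)" "inj (tangent_map X p)"
    and M: "is_weingarten_matrix X N p M" and k: "principal_curvatures X N p l1 l2"
  shows "mean_curvature X N D p = - causal_sign X D * ((l1 + l2) / 2)"
  unfolding mean_curvature_def
proof (rule the_equality)
  show "\<exists>k1 k2. principal_curvatures X N p k1 k2 \<and>
      - causal_sign X D * ((l1 + l2) / 2) = - causal_sign X D * ((k1 + k2) / 2)"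
    using k by blast
next
  fix H
  assume "\<exists>k1 k2. principal_curvatures X N p k1 k2 \<and> H = - causal_sign X D * ((k1 + k2) / 2)"
  then obtain k1 k2 where "principal_curvatures X N p k1 k2"
    and H: "H = - causal_sign X D * ((k1 + k2) / 2)" by blast
  then have "k1 + k2 = l1 + l2"
    using principal_curvatures_sum[OF D N X M] k by simp
  then show "H = - causal_sign X D * ((l1 + l2) / 2)" using H by simp
qed

lemma rot_conjugate_entries:
  fixes l1 l2 \<alpha> :: real
  defines "M \<equiv> rot (- \<alpha>) ** diag2 l1 l2 ** rot \<alpha>"
  shows "M $ 1 $ 1 = (l1 + l2) / 2 + (l1 - l2) / 2 * cos (2 * \<alpha>)"
    "M $ 1 $ 2 = - ((l1 - l2) / 2 * sin (2 * \<alpha>))"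
    "M $ 2 $ 1 = - ((l1 - l2) / 2 * sin (2 * \<alpha>))"
    "M $ 2 $ 2 = (l1 + l2) / 2 - (l1 - l2) / 2 * cos (2 * \<alpha>)"
  unfolding M_def cos_double_cos sin_double
  by (simp_all add: matrix_matrix_mult_def sum_2 rot_def diag2_def
      sin_squared_eq power2_eq_square[symmetric] field_simps)

lemma boost_conjugate_entries:
  fixes l1 l2 \<alpha> :: real
  defines "M \<equiv> boost (- \<alpha>) ** diag2 l1 l2 ** boost \<alpha>"
  shows "M $ 1 $ 1 = (l1 + l2) / 2 + (l1 - l2) / 2 * cosh (2 * \<alpha>)"
    "M $ 1 $ 2 = (l1 - l2) / 2 * sinh (2 * \<alpha>)"
    "M $ 2 $ 1 = - ((l1 - l2) / 2 * sinh (2 * \<alpha>))"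
    "M $ 2 $ 2 = (l1 + l2) / 2 - (l1 - l2) / 2 * cosh (2 * \<alpha>)"
  unfolding M_def cosh_double_cosh sinh_double
  by (simp_all add: matrix_matrix_mult_def sum_2 boost_def diag2_def
      sinh_square_eq power2_eq_square[symmetric] field_simps)

text \<open>
  The equation says that \<open>\<alpha>\<close> takes values among the integer multiples of \<open>\<pi>/2\<close>. Distinct ones are
  at least \<open>\<pi>/2\<close> apart, so a continuous function cannot pass from one to another on a connected set.
\<close>

lemma sin_double_zero_imp_constant:
  fixes \<alpha> :: "real \<Rightarrow> real"
  assumes J: "connected J" "J \<noteq> {}" and \<alpha>: "continuous_on J \<alpha>"
    and zero: "\<And>v. v \<in> J \<Longrightarrow> sin (2 * \<alpha> v) = 0"
  shows "\<exists>k::int. \<forall>v\<in>J. \<alpha> v = of_int k * (pi / 2)"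
proof -
  have quant: "\<exists>k::int. \<alpha> v = of_int k * (pi / 2)" if "v \<in> J" for v
    using zero[OF that] by (auto simp: sin_zero_iff_int2 field_simps)
  have "\<alpha> constant_on J"
  proof (rule continuous_discrete_range_constant[OF J(1) \<alpha>])
    fix v assume v: "v \<in> J"
    have "pi / 2 \<le> norm (\<alpha> t - \<alpha> v)" if t: "t \<in> J" "\<alpha> t \<noteq> \<alpha> v" for t
    proof -
      obtain k l :: int where k: "\<alpha> v = of_int k * (pi / 2)" and l: "\<alpha> t = of_int l * (pi / 2)"
        using quant v t by blast
      have "1 \<le> \<bar>l - k\<bar>" using t(2) k l by auto
      then have "1 \<le> \<bar>real_of_int (l - k)\<bar>" by linarith
      then have "1 * (pi / 2) \<le> \<bar>real_of_int (l - k)\<bar> * (pi / 2)"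
        by (rule mult_right_mono) simp
      moreover have eq: "\<alpha> t - \<alpha> v = real_of_int (l - k) * (pi / 2)"
        by (simp add: k l algebra_simps)
      have "norm (\<alpha> t - \<alpha> v) = \<bar>real_of_int (l - k)\<bar> * (pi / 2)"
        unfolding eq real_norm_def abs_mult by simp
      ultimately show ?thesis by linarith
    qed
    then show "\<exists>e>0. \<forall>t. t \<in> J \<and> \<alpha> t \<noteq> \<alpha> v \<longrightarrow> e \<le> norm (\<alpha> t - \<alpha> v)"
      by (intro exI[of _ "pi / 2"]) simp
  qed
  then show ?thesis using J(2) quant unfolding constant_on_def by (metis ex_in_conv)
qed

lemma affine_if_constant_derivative:
  fixes \<alpha> :: "real \<Rightarrow> real"
  assumes J: "convex J" and \<alpha>: "\<And>v. v \<in> J \<Longrightarrow> (\<alpha> has_real_derivative a) (at v)"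
  shows "\<exists>c. \<forall>v\<in>J. \<alpha> v = a * v + c"
proof -
  have "((\<lambda>t. \<alpha> t - a * t) has_real_derivative 0) (at v within J)" if "v \<in> J" for v
    using has_field_derivative_at_within[OF \<alpha>[OF that]] by (auto intro!: derivative_eq_intros)
  then obtain c where "\<And>v. v \<in> J \<Longrightarrow> \<alpha> v - a * v = c"
    using has_field_derivative_zero_constant[OF J, of "\<lambda>t. \<alpha> t - a * t"] by blast
  then show ?thesis by (metis add.commute diff_add_cancel)
qed

text \<open>
  The two signs are prescribed by the causal character: the form is definite if and only if
  \<open>\<delta> = \<epsilon>\<close>. This decides which of the two twist matrices goes with which sign \<open>\<delta> * \<epsilon>\<close>.
\<close>

lemma causal_character_signs:
  assumes p: "p \<in> D" and r: "r > 0" and nd: "spacelike X D \<or> timelike X D"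
    and q: "\<And>a b. first_fundamental_form X p (a, b) (a, b) = r * (\<delta> * a\<^sup>2 + \<epsilon> * b\<^sup>2)"
    and sgn: "\<delta> \<in> {-1, 1}" "\<epsilon> \<in> {-1, 1}"
  shows "\<delta> * \<epsilon> = (if spacelike X D then 1 else -1)"
proof (cases "spacelike X D")
  case True
  then have pos: "first_fundamental_form X p \<xi> \<xi> > 0" if "\<xi> \<noteq> 0" for \<xi>
    using p that unfolding spacelike_def by blast
  show ?thesis
    using pos[of "(1, 0)"] pos[of "(0, 1)"] r sgn True unfolding q by (auto simp: zero_prod_def)
next
  case False
  then obtain \<xi> \<eta> where "first_fundamental_form X p \<xi> \<xi> < 0" "first_fundamental_form X p \<eta> \<eta> > 0"
    using nd p by (auto simp: timelike_def)
  then have "\<exists>a b. \<delta> * a\<^sup>2 + \<epsilon> * b\<^sup>2 < 0" "\<exists>a b. \<delta> * a\<^sup>2 + \<epsilon> * b\<^sup>2 > 0"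
    using r by (metis q surj_pair mult_less_0_iff less_asym, metis q surj_pair zero_less_mult_pos)
  moreover have "0 \<le> a\<^sup>2 + b\<^sup>2" "- (a\<^sup>2) - b\<^sup>2 \<le> 0" for a b :: real by simp_all
  ultimately show ?thesis using sgn False by (force simp: not_less[symmetric])
qed

theorem theorem1p4:
  fixes X N :: "real \<times> real \<Rightarrow> real^3" and I J :: "real set" and \<alpha> :: "real \<Rightarrow> real"
  assumes "intrinsic_rotational_surface X I J"
    and "unit_normal_field X N (I \<times> J)"
    and "has_twist X N I J \<alpha>"
    and "\<exists>v\<in>J. \<alpha> v \<noteq> 0"
    and "\<not> (\<exists>U. open U \<and> U \<noteq> {} \<and> U \<subseteq> I \<times> J \<and> (\<forall>p\<in>U. umbilic X N p))"
    and "spacelike X (I \<times> J) \<Longrightarrow>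
      \<not> (\<exists>K. open_interval K \<and> K \<subseteq> J \<and> (\<exists>k::int. \<forall>v\<in>K. \<alpha> v = of_int k * (pi / 2)))"
  shows "(\<exists>H\<^sub>0. \<forall>p\<in>I \<times> J. mean_curvature X N (I \<times> J) p = H\<^sub>0) \<and>
    (\<exists>a c. \<forall>v\<in>J. \<alpha> v = a * v + c)"
proof -
  let ?D = "I \<times> J"
  let ?sp = "spacelike X ?D"
  have I: "open_interval I" and J: "open_interval J" and nd: "nondegenerate_surface X ?D"
    using assms(1) unfolding intrinsic_rotational_surface_def by auto
  obtain \<rho> :: "real \<Rightarrow> real" and \<delta> \<epsilon> :: real
    where metric: "smooth_on I \<rho> \<and> (\<forall>u\<in>I. \<rho> u > 0) \<and> \<delta> \<in> {-1, 1} \<and> \<epsilon> \<in> {-1, 1} \<and>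
      (\<forall>u\<in>I. \<forall>v\<in>J. \<forall>a b. first_fundamental_form X (u, v) (a, b) (a, b)
        = (\<rho> u)\<^sup>2 * (\<delta> * a\<^sup>2 + \<epsilon> * b\<^sup>2))"
    using assms(1) unfolding intrinsic_rotational_surface_def
    by (elim conjE exE) (rule that, intro conjI)
  then have \<rho>: "smooth_on I \<rho>" "\<And>u. u \<in> I \<Longrightarrow> \<rho> u > 0" and sgn: "\<delta> \<in> {-1, 1}" "\<epsilon> \<in> {-1, 1}"
    and ff: "\<And>u v a b. u \<in> I \<Longrightarrow> v \<in> J \<Longrightarrow> first_fundamental_form X (u, v) (a, b) (a, b)
        = (\<rho> u)\<^sup>2 * (\<delta> * a\<^sup>2 + \<epsilon> * b\<^sup>2)"
    by blast+
  have D: "open ?D" and X: "smooth_on ?D X" and inj: "\<And>p. p \<in> ?D \<Longrightarrow> inj (tangent_map X p)"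
    and sptl: "?sp \<or> timelike X ?D"
    using nd unfolding nondegenerate_surface_def by auto
  have N: "smooth_on ?D N" using assms(2) by (simp add: unit_normal_field_def)
  have Idom: "open I" "connected I" "I \<noteq> {}" and Jdom: "open J" "connected J" "J \<noteq> {}" "convex J"
    using I J by (auto simp: open_interval_def is_interval_connected is_interval_convex)
  have Xdiff: "X differentiable (at p)" if "p \<in> ?D" for p
    using X that by (rule smooth_on_differentiable)
  obtain l1 l2 where \<alpha>: "smooth_on J \<alpha>"
    and pc: "\<And>u v. u \<in> I \<Longrightarrow> v \<in> J \<Longrightarrow> principal_curvatures X N (u, v) (l1 u) (l2 u)"
    and wm: "\<And>u v. u \<in> I \<Longrightarrow> v \<in> J \<Longrightarrow> is_weingarten_matrix X N (u, v)
          (if ?sp then rot (- \<alpha> v) ** diag2 (l1 u) (l2 u) ** rot (\<alpha> v)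
           else boost (- \<alpha> v) ** diag2 (l1 u) (l2 u) ** boost (\<alpha> v))"
    using assms(3) unfolding has_twist_def by blast
  define h where "h u = (l1 u + l2 u) / 2" for u
  define w where "w u = (l1 u - l2 u) / 2" for u
  define C where "C v = (if ?sp then cos (2 * \<alpha> v) else cosh (2 * \<alpha> v))" for v
  define S where "S v = (if ?sp then sin (2 * \<alpha> v) else sinh (2 * \<alpha> v))" for v
  have \<alpha>': "(\<alpha> has_real_derivative deriv \<alpha> v) (at v)" if "v \<in> J" for v
    using smooth_on_differentiable[OF \<alpha> that] by (simp add: DERIV_deriv_iff_real_differentiable)
  have \<rho>': "(\<rho> has_real_derivative deriv \<rho> u) (at u)" if "u \<in> I" for u
    using smooth_on_differentiable[OF \<rho>(1) that] by (simp add: DERIV_deriv_iff_real_differentiable)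
  obtain u1 v1 where uv1: "u1 \<in> I" "v1 \<in> J" using Idom Jdom by blast
  have \<kappa>: "\<delta> * \<epsilon> = (if ?sp then 1 else -1)"
    by (rule causal_character_signs[of "(u1, v1)" _ "(\<rho> u1)\<^sup>2"])
      (use uv1 \<rho>(2)[OF uv1(1)] sptl sgn ff[OF uv1] in auto)
  have dN: "du N (u, v) = - ((h u + w u * C v) *\<^sub>R du X (u, v) - (w u * S v) *\<^sub>R dv X (u, v))"
    "dv N (u, v) = - (- (\<delta> * \<epsilon> * w u * S v) *\<^sub>R du X (u, v) + (h u - w u * C v) *\<^sub>R dv X (u, v))"
    if uv: "u \<in> I" "v \<in> J" for u v
  proof -
    have p: "(u, v) \<in> ?D" using uv by simp
    have W: "- du N (u, v) = weingarten N (u, v) (1, 0)" "- dv N (u, v) = weingarten N (u, v) (0, 1)"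
      by (simp_all add: weingarten_coordinates[OF D p assms(2)])
    have T: "tangent_map X (u, v) (1, 0) = du X (u, v)" "tangent_map X (u, v) (0, 1) = dv X (u, v)"
      by (simp_all add: tangent_map_coordinates[OF Xdiff[OF p]])
    have "- du N (u, v) = (h u + w u * C v) *\<^sub>R du X (u, v) - (w u * S v) *\<^sub>R dv X (u, v) \<and>
      - dv N (u, v) = - (\<delta> * \<epsilon> * w u * S v) *\<^sub>R du X (u, v) + (h u - w u * C v) *\<^sub>R dv X (u, v)"
      using wm[OF uv] unfolding W \<kappa>
      by (cases ?sp) (simp_all add: is_weingarten_matrix_def T rot_conjugate_entries
          boost_conjugate_entries C_def S_def flip: h_def w_def)
    then show "du N (u, v) = - ((h u + w u * C v) *\<^sub>R du X (u, v) - (w u * S v) *\<^sub>R dv X (u, v))"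
      "dv N (u, v) = - (- (\<delta> * \<epsilon> * w u * S v) *\<^sub>R du X (u, v) + (h u - w u * C v) *\<^sub>R dv X (u, v))"
      by (metis minus_minus)+
  qed
  interpret surface: twisted_surface X N I J \<rho> "deriv \<rho>" h w C S "deriv \<alpha>" \<delta> \<epsilon>
  proof
    show "lorentz (du X (u, v)) (du X (u, v)) = \<delta> * (\<rho> u)\<^sup>2" "lorentz (du X (u, v)) (dv X (u, v)) = 0"
      "lorentz (dv X (u, v)) (dv X (u, v)) = \<epsilon> * (\<rho> u)\<^sup>2" if "u \<in> I" "v \<in> J" for u v
      using metric_coefficients[OF Xdiff ff[OF that]] that by auto
    show "(C has_real_derivative - (\<delta> * \<epsilon> * 2 * deriv \<alpha> v * S v)) (at v)" if "v \<in> J" for v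
      unfolding \<kappa> C_def[abs_def] S_def using \<alpha>'[OF that]
      by (cases ?sp) (auto intro!: derivative_eq_intros)
    show "(S has_real_derivative 2 * deriv \<alpha> v * C v) (at v)" if "v \<in> J" for v
      unfolding S_def[abs_def] C_def using \<alpha>'[OF that]
      by (cases ?sp) (auto intro!: derivative_eq_intros)
    show "(C v)\<^sup>2 + \<delta> * \<epsilon> * (S v)\<^sup>2 = 1" for v
      unfolding \<kappa> C_def S_def by (simp add: cosh_square_eq)
  qed (use Idom Jdom X N sgn \<rho> \<rho>' dN in auto)
  have "\<exists>v\<in>J. S v \<noteq> 0"
  proof (cases ?sp)
    case True
    then have "\<not> (\<exists>k::int. \<forall>v\<in>J. \<alpha> v = of_int k * (pi / 2))" using assms(6) J by blast
    then show ?thesis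
      using sin_double_zero_imp_constant[OF Jdom(2,3) smooth_on_continuous_on[OF \<alpha>]] True
      by (auto simp: S_def)
  next
    case False
    then show ?thesis using assms(4) by (simp add: S_def)
  qed
  then obtain v0 where v0: "v0 \<in> J" "S v0 \<noteq> 0" by blast
  have "\<exists>u\<in>I. w u \<noteq> 0"
  proof (rule ccontr)
    assume "\<not> (\<exists>u\<in>I. w u \<noteq> 0)"
    then have "umbilic X N p" if "p \<in> ?D" for p
      using pc that by (fastforce simp: umbilic_def w_def)
    then show False using assms(5) D uv1 by blast
  qed
  then obtain u0 where u0: "u0 \<in> I" "w u0 \<noteq> 0" by blast
  obtain H a where H: "\<And>u. u \<in> I \<Longrightarrow> h u = H" and a: "\<And>v. v \<in> J \<Longrightarrow> deriv \<alpha> v = a"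
    using surface.rigidity[OF v0 u0] by blast
  have "mean_curvature X N ?D p = - causal_sign X ?D * H" if pD: "p \<in> ?D" for p
  proof -
    obtain u v where p: "p = (u, v)" "u \<in> I" "v \<in> J" using pD by blast
    show ?thesis
      using mean_curvature_eq[OF D pD assms(2) Xdiff[OF pD] inj[OF pD]]
        wm[OF p(2,3)] pc[OF p(2,3)] H[OF p(2)] unfolding p(1) h_def by blast
  qed
  moreover have "\<exists>c. \<forall>v\<in>J. \<alpha> v = a * v + c"
    using \<alpha>' a by (intro affine_if_constant_derivative Jdom) auto
  ultimately show ?thesis by blast
qed

end
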